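(* Every finite tournament is a subtournament of a finite regular tournament. That is, for every finite tournament $T$ there exist a finite regular tournament $R$ and an injective map $f$ from the vertex set of $T$ to the vertex set of $R$ such that for all vertices $x,y$ of $T$, $x\to y$ in $T$ if and only if $f(x)\to f(y)$ in $R$.
   Context: A tournament is a pair $T=(V,E)$, where $V$ is a finite nonempty set of vertices and $E\subseteq V\times V$ is a relation such that $(v,v)\notin E$ for all $v$, and for any two distinct $u,v\in V$ exactly one of $(u,v)\in E$, $(v,u)\in E$ holds. We write $u\to v$ when $(u,v)\in E$. For a vertex $v$, the indegree is $\mathrm{in}(v)=|\{u\in V: u\to v\}|$ and the outdegree is $\mathrm{out}(v)=|\{u\in V: v\to u\}|$. A tournament is regular if $\mathrm{in}(v)=\mathrm{out}(v)$ for every vertex $v$. *)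

theory Defs
  imports "HOL-Library.FuncSet"
begin

definition tournament :: "'a set \<Rightarrow> ('a \<times> 'a) set \<Rightarrow> bool" where
  "tournament V E \<longleftrightarrow>
     finite V \<and> V \<noteq> {} \<and> E \<subseteq> V \<times> V \<and>
     (\<forall>v\<in>V. (v, v) \<notin> E) \<and>
     (\<forall>u\<in>V. \<forall>v\<in>V. u \<noteq> v \<longrightarrow> ((u, v) \<in> E \<and> (v, u) \<notin> E) \<or> ((u, v) \<notin> E \<and> (v, u) \<in> E))"

definition indegree :: "'a set \<Rightarrow> ('a \<times> 'a) set \<Rightarrow> 'a \<Rightarrow> nat" where
  "indegree V E v = card {u \<in> V. (u, v) \<in> E}"

definition outdegree :: "'a set \<Rightarrow> ('a \<times> 'a) set \<Rightarrow> 'a \<Rightarrow> nat" where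
  "outdegree V E v = card {u \<in> V. (v, u) \<in> E}"

definition regular_tournament :: "'a set \<Rightarrow> ('a \<times> 'a) set \<Rightarrow> bool" where
  "regular_tournament V E \<longleftrightarrow>
     tournament V E \<and> (\<forall>v\<in>V. indegree V E v = outdegree V E v)"

definition tournament_embedding ::
  "'a set \<Rightarrow> ('a \<times> 'a) set \<Rightarrow> 'b set \<Rightarrow> ('b \<times> 'b) set \<Rightarrow> ('a \<Rightarrow> 'b) \<Rightarrow> bool" where
  "tournament_embedding V E W F f \<longleftrightarrow>
     f \<in> V \<rightarrow> W \<and> inj_on f V \<and>
     (\<forall>x\<in>V. \<forall>y\<in>V. (x, y) \<in> E \<longleftrightarrow> (f x, f y) \<in> F)"

end

theory Submission
  imports Defs
begin

text \<open>Take two copies of the tournament and one further vertex \<open>z\<close>. Between the copies, join distinct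
  vertices against their orientation in the tournament, and close each pair of twins to a 3-cycle
  through \<open>z\<close>. Swapping the two copies then turns in-neighbours of a vertex into out-neighbours,
  except that \<open>z\<close> has to be exchanged with the twin of that vertex.\<close>

fun double_edge :: "('a \<times> 'a) set \<Rightarrow> ('a \<times> bool) option \<Rightarrow> ('a \<times> bool) option \<Rightarrow> bool" where
  "double_edge E (Some (u, b)) (Some (v, c)) \<longleftrightarrow>
     (if u = v then \<not> b \<and> c else if b = c then (u, v) \<in> E else (v, u) \<in> E)"
| "double_edge E (Some (u, b)) None \<longleftrightarrow> b"
| "double_edge E None (Some (u, b)) \<longleftrightarrow> \<not> b"
| "double_edge E None None \<longleftrightarrow> False"

text \<open>\<open>None\<close> is the extra vertex \<open>z\<close>, and the Boolean tells the two
  copies apart. The 3-cycle through twins runs from \<open>Some (u, False)\<close> to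
  \<open>Some (u, True)\<close> to \<open>None\<close> and back.\<close>

definition double_verts :: "'a set \<Rightarrow> ('a \<times> bool) option set" where
  "double_verts V = insert None (Some ` (V \<times> UNIV))"

definition double_edges :: "'a set \<Rightarrow> ('a \<times> 'a) set \<Rightarrow> (('a \<times> bool) option \<times> ('a \<times> bool) option) set" where
  "double_edges V E = {(x, y). x \<in> double_verts V \<and> y \<in> double_verts V \<and> double_edge E x y}"

fun twin :: "('a \<times> bool) option \<Rightarrow> ('a \<times> bool) option" where
  "twin (Some (u, b)) = Some (u, \<not> b)"
| "twin None = None"

text \<open>For fixed \<open>x\<close> this is the map meant to match in-neighbours of
  \<open>x\<close> with out-neighbours. For \<open>x = None\<close> it is just
  \<open>twin\<close>.\<close>

definition swap_nbrs :: "('a \<times> bool) option \<Rightarrow> ('a \<times> bool) option \<Rightarrow> ('a \<times> bool) option" where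
  "swap_nbrs x y = (if y = None then twin x else if y = twin x then None else twin y)"

lemma twin_twin [simp]: "twin (twin x) = x"
  by (cases x rule: twin.cases) auto

lemma twin_eq_iff [simp]: "twin x = twin y \<longleftrightarrow> x = y"
  by (metis twin_twin)

lemma twin_eq_None_iff [simp]: "twin x = None \<longleftrightarrow> x = None"
  by (cases x rule: twin.cases) auto

lemma twin_in_double_verts [simp]: "twin x \<in> double_verts V \<longleftrightarrow> x \<in> double_verts V"
  by (cases x rule: twin.cases) (auto simp: double_verts_def)

lemma swap_nbrs_in_double_verts:
  "x \<in> double_verts V \<Longrightarrow> y \<in> double_verts V \<Longrightarrow> swap_nbrs x y \<in> double_verts V"
  by (auto simp: swap_nbrs_def) (simp add: double_verts_def)

text \<open>The case \<open>y = x\<close> is excluded because a vertex \<open>x\<close> other than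
  \<open>None\<close> would go to \<open>twin x\<close> and then to \<open>None\<close>.\<close>

lemma swap_nbrs_swap_nbrs:
  assumes "y \<noteq> x"
  shows "swap_nbrs x (swap_nbrs x y) = y"
  using assms by (auto simp: swap_nbrs_def)

text \<open>If \<open>x\<close> and \<open>y\<close> lie over different vertices, passing to
  \<open>twin y\<close> changes whether the copies agree, which reverses the edge. Over the same
  vertex, or if one of them is \<open>None\<close>, the 3-cycle decides: \<open>x\<close> has one of
  \<open>None\<close> and \<open>twin x\<close> before it and the other after it.\<close>

lemma double_edge_swap_nbrs:
  assumes "y \<noteq> x"
  shows "double_edge E (swap_nbrs x y) x \<longleftrightarrow> double_edge E x y"
    and "double_edge E x (swap_nbrs x y) \<longleftrightarrow> double_edge E y x"
  using assms
  by (cases x rule: twin.cases; cases y rule: twin.cases; auto simp: swap_nbrs_def)+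

lemma double_edge_irrefl: "\<not> double_edge E x x"
  by (cases x rule: twin.cases) auto

lemma tournament_double:
  assumes "tournament V E"
  shows "tournament (double_verts V) (double_edges V E)"
proof -
  \<comment> \<open>Over different vertices this is inherited from \<open>E\<close>; for twins and
    for pairs with \<open>None\<close> the Boolean conditions give it.\<close>
  have "double_edge E x y \<longleftrightarrow> \<not> double_edge E y x"
    if "x \<in> double_verts V" "y \<in> double_verts V" "x \<noteq> y" for x y
    using that assms
    by (cases x rule: twin.cases; cases y rule: twin.cases)
      (auto simp: double_verts_def tournament_def)
  moreover have "finite (double_verts V)" "double_verts V \<noteq> {}"
    using assms by (auto simp: double_verts_def tournament_def)
  moreover have "double_edges V E \<subseteq> double_verts V \<times> double_verts V"
    by (auto simp: double_edges_def)
  moreover have "(x, y) \<in> double_edges V E \<longleftrightarrow> double_edge E x y"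
    if "x \<in> double_verts V" "y \<in> double_verts V" for x y
    using that by (simp add: double_edges_def)
  ultimately show ?thesis
    unfolding tournament_def using double_edge_irrefl by metis
qed

lemma regular_tournament_double:
  assumes "tournament V E"
  shows "regular_tournament (double_verts V) (double_edges V E)"
  unfolding regular_tournament_def
proof (intro conjI ballI)
  show "tournament (double_verts V) (double_edges V E)"
    by (rule tournament_double[OF assms])
  fix x assume x: "x \<in> double_verts V"
  let ?In = "{y \<in> double_verts V. (y, x) \<in> double_edges V E}"
  let ?Out = "{y \<in> double_verts V. (x, y) \<in> double_edges V E}"
  \<comment> \<open>There are no loops, so the facts on \<open>swap_nbrs\<close> apply to every
    neighbour of \<open>x\<close>.\<close>
  have neq: "y \<noteq> x" if "y \<in> ?In \<union> ?Out" for y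
    using that by (auto simp: double_edges_def double_edge_irrefl)
  have "bij_betw (swap_nbrs x) ?In ?Out"
  \<comment> \<open>The map is its own inverse, so two inclusions suffice.\<close>
  proof (rule bij_betw_byWitness[where f' = "swap_nbrs x"])
    show "swap_nbrs x ` ?In \<subseteq> ?Out" "swap_nbrs x ` ?Out \<subseteq> ?In"
      using x neq
      by (auto simp: double_edges_def double_edge_swap_nbrs swap_nbrs_in_double_verts)
  qed (use neq in \<open>auto simp: swap_nbrs_swap_nbrs\<close>)
  then show "indegree (double_verts V) (double_edges V E) x
      = outdegree (double_verts V) (double_edges V E) x"
    unfolding indegree_def outdegree_def by (rule bij_betw_same_card)
qed

text \<open>Inside one copy the edges are those of \<open>E\<close>; on the diagonal,
  \<open>double_edge\<close> is false, in accordance with the irreflexivity of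
  \<open>E\<close>.\<close>

lemma tournament_embedding_double:
  "tournament V E \<Longrightarrow>
    tournament_embedding V E (double_verts V) (double_edges V E) (\<lambda>v. Some (v, False))"
  by (auto simp: tournament_embedding_def double_verts_def double_edges_def inj_on_def tournament_def)

lemma map_prod_image_mem_iff:
  assumes "inj_on h V" "E \<subseteq> V \<times> V" "x \<in> V" "y \<in> V"
  shows "(h x, h y) \<in> map_prod h h ` E \<longleftrightarrow> (x, y) \<in> E"
  using inj_on_image_mem_iff[OF map_prod_inj_on[OF assms(1) assms(1)], of "(x, y)" E] assms(2-4)
  by simp

text \<open>Renaming along an injection carries neighbourhoods to neighbourhoods of the same size.
  This serves to move the double, whose vertices have an option type, to the naturals.\<close>

lemma regular_tournament_image:
  assumes reg: "regular_tournament V E" and inj: "inj_on h V"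
  shows "regular_tournament (h ` V) (map_prod h h ` E)"
proof -
  have E: "E \<subseteq> V \<times> V"
    using reg by (simp add: regular_tournament_def tournament_def)
  note edge = map_prod_image_mem_iff[OF inj E]
  have "tournament (h ` V) (map_prod h h ` E)"
    unfolding tournament_def
  proof (intro conjI)
    show "map_prod h h ` E \<subseteq> h ` V \<times> h ` V"
      using E by auto
  qed (use reg in \<open>auto simp: regular_tournament_def tournament_def edge\<close>)
  moreover have "indegree (h ` V) (map_prod h h ` E) (h x) = indegree V E x"
      and "outdegree (h ` V) (map_prod h h ` E) (h x) = outdegree V E x" if x: "x \<in> V" for x
  proof -
    have "{u \<in> h ` V. (u, h x) \<in> map_prod h h ` E} = h ` {u \<in> V. (u, x) \<in> E}"
      and "{u \<in> h ` V. (h x, u) \<in> map_prod h h ` E} = h ` {u \<in> V. (x, u) \<in> E}"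
      using x by (simp_all add: Compr_image_eq edge cong: conj_cong)
    moreover have "inj_on h {u \<in> V. P u}" for P
      by (rule inj_on_subset[OF inj]) auto
    ultimately show "indegree (h ` V) (map_prod h h ` E) (h x) = indegree V E x"
      and "outdegree (h ` V) (map_prod h h ` E) (h x) = outdegree V E x"
      by (simp_all add: indegree_def outdegree_def card_image)
  qed
  ultimately show ?thesis
    using reg by (auto simp: regular_tournament_def)
qed

lemma tournament_embedding_image:
  assumes emb: "tournament_embedding V E W F f" and F: "F \<subseteq> W \<times> W" and inj: "inj_on h W"
  shows "tournament_embedding V E (h ` W) (map_prod h h ` F) (h \<circ> f)"
proof -
  have f: "f ` V \<subseteq> W" and inj_f: "inj_on f V"
    using emb by (auto simp: tournament_embedding_def)
  have "inj_on (h \<circ> f) V"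
    by (rule comp_inj_on[OF inj_f inj_on_subset[OF inj f]])
  then show ?thesis
    using emb f by (auto simp: tournament_embedding_def image_subset_iff map_prod_image_mem_iff[OF inj F])
qed

theorem theorem3p3:
  fixes V :: "'a set" and E :: "('a \<times> 'a) set"
  assumes "tournament V E"
  shows "\<exists>(W :: nat set) (F :: (nat \<times> nat) set) (f :: 'a \<Rightarrow> nat).
           regular_tournament W F \<and> tournament_embedding V E W F f"
proof -
  let ?W = "double_verts V" and ?F = "double_edges V E"
  have reg: "regular_tournament ?W ?F"
    by (rule regular_tournament_double[OF assms])
  then have "finite ?W" and F: "?F \<subseteq> ?W \<times> ?W"
    by (simp_all add: regular_tournament_def tournament_def)
  \<comment> \<open>Finiteness of the double yields an injective numbering of its vertices; the
    required \<open>W\<close>, \<open>F\<close> and \<open>f\<close> are the images under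
    it.\<close>
  then obtain h :: "('a \<times> bool) option \<Rightarrow> nat" where h: "inj_on h ?W"
    using finite_imp_inj_to_nat_seg by metis
  show ?thesis
    using regular_tournament_image[OF reg h]
      tournament_embedding_image[OF tournament_embedding_double[OF assms] F h] by blast
qed

end
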